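(* Let $H$ be a ribbon Hopf algebra. Each finite dimensional $H$-module $V$ gives rise to a numerical invariant of framed oriented virtual links whose restriction to classical links coincides with the Reshetikhin--Turaev invariant attached to $V$.
   Context: Framed oriented virtual links. Let $v\mathcal T_0$ be the strict monoidal category whose objects are associative words on $\{+,-\}$ and whose morphisms are compositions (and juxtapositions) of the following planar diagrams, with all possible orientations and the usual compatibility between orientations and the letters at endpoints: positive crossing, negative crossing, virtual crossing, cap $\cap$, cup $\cup$; modulo: planar isotopy; the Reidemeister moves for framed oriented tangles; the virtual Reidemeister moves $v\circ v=\mathrm{id}$ and $v_1v_2v_1=v_2v_1v_2$; and the mixed relation $v_1c_2v_1=v_2c_1v_2$, where $v_i$ (resp. $c_i$) denotes the virtual (resp. positive) crossing on the strands in positions $i,i+1$ of three strands. The virtual analogue of the first Reidemeister move is not imposed (so these are "rotational" virtual tangles). A framed oriented virtual link is an endomorphism of the empty word in $v\mathcal T_0$; classical framed oriented links are regarded as virtual links through diagrams without virtual crossings. A numerical invariant is one with values in the ground field of $H$. Reshetikhin--Turaev invariant. The category $H\text{-mod}$ of finite dimensional $H$-modules is a ribbon category. Let $\mathcal T$ be the ribbon category whose objects are parenthesised words on $\{+,-\}$ (elements of the free non-associative monoid on $\{+,-\}$) and whose morphisms are isotopy classes of framed oriented tangles between the underlying associative words. For $V\in H\text{-mod}$ there is a unique strict monoidal functor $F_V:\mathcal T\to H\text{-mod}$ preserving the braiding and the ribbon structure with $F_V(+)=V$ and $F_V(-)=V^*$. The Reshetikhin--Turaev invariant of a framed oriented link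 $L$, seen as an endomorphism of the empty word, attached to $V$ is the scalar $F_V(L)$, an endomorphism of the trivial module, identified with an element of the ground field. *)

theory Defs
  imports "HOL.Vector_Spaces" "HOL-Library.FuncSet" "Jordan_Normal_Form.Matrix"
begin

section \<open>Ribbon Hopf algebras\<close>

text \<open>
  An element of the tensor product of \<open>A\<close> with itself over the field \<open>k\<close> is given by a formal sum
  of pure tensors, i.e. a list of pairs (and likewise with triples).  Two formal sums represent the
  same tensor iff every bilinear (trilinear) form takes the same value on them; over a field these
  forms separate the points of the tensor product.  A comprehension \<open>[(f a, g b). (a, b) \<leftarrow> comul H x]\<close>
  is thus Sweedler notation for the sum of the \<open>f x\<^sub>1 \<otimes> g x\<^sub>2\<close>.
\<close>

definition bilinear_form ::
  "('k::field \<Rightarrow> 'a::ab_group_add \<Rightarrow> 'a) \<Rightarrow> ('a \<Rightarrow> 'a \<Rightarrow> 'k) \<Rightarrow> bool" where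
  "bilinear_form sc \<phi> \<longleftrightarrow>
     (\<forall>b. Vector_Spaces.linear sc (*) (\<lambda>a. \<phi> a b)) \<and>
     (\<forall>a. Vector_Spaces.linear sc (*) (\<lambda>b. \<phi> a b))"

definition trilinear_form ::
  "('k::field \<Rightarrow> 'a::ab_group_add \<Rightarrow> 'a) \<Rightarrow> ('a \<Rightarrow> 'a \<Rightarrow> 'a \<Rightarrow> 'k) \<Rightarrow> bool" where
  "trilinear_form sc \<phi> \<longleftrightarrow>
     (\<forall>b c. Vector_Spaces.linear sc (*) (\<lambda>a. \<phi> a b c)) \<and>
     (\<forall>a c. Vector_Spaces.linear sc (*) (\<lambda>b. \<phi> a b c)) \<and>
     (\<forall>a b. Vector_Spaces.linear sc (*) (\<lambda>c. \<phi> a b c))"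

definition tensor2_eq ::
  "('k::field \<Rightarrow> 'a::ab_group_add \<Rightarrow> 'a) \<Rightarrow> ('a \<times> 'a) list \<Rightarrow> ('a \<times> 'a) list \<Rightarrow> bool" where
  "tensor2_eq sc X Y \<longleftrightarrow>
     (\<forall>\<phi>. bilinear_form sc \<phi> \<longrightarrow> (\<Sum>(a, b)\<leftarrow>X. \<phi> a b) = (\<Sum>(a, b)\<leftarrow>Y. \<phi> a b))"

definition tensor3_eq ::
  "('k::field \<Rightarrow> 'a::ab_group_add \<Rightarrow> 'a) \<Rightarrow> ('a \<times> 'a \<times> 'a) list \<Rightarrow> ('a \<times> 'a \<times> 'a) list \<Rightarrow> bool" where
  "tensor3_eq sc X Y \<longleftrightarrow>
     (\<forall>\<phi>. trilinear_form sc \<phi> \<longrightarrow> (\<Sum>(a, b, c)\<leftarrow>X. \<phi> a b c) = (\<Sum>(a, b, c)\<leftarrow>Y. \<phi> a b c))"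

definition tensor_mult :: "('a::ring_1 \<times> 'a) list \<Rightarrow> ('a \<times> 'a) list \<Rightarrow> ('a \<times> 'a) list" where
  "tensor_mult X Y = [(a * c, b * d). (a, b) \<leftarrow> X, (c, d) \<leftarrow> Y]"

definition tensor_swap :: "('a \<times> 'a) list \<Rightarrow> ('a \<times> 'a) list" where
  "tensor_swap X = [(b, a). (a, b) \<leftarrow> X]"

record ('k, 'h) hopf_data =
  scal :: "'k \<Rightarrow> 'h \<Rightarrow> 'h"
  comul :: "'h \<Rightarrow> ('h \<times> 'h) list"
  counit :: "'h \<Rightarrow> 'k"
  antipode :: "'h \<Rightarrow> 'h"
  Rmat :: "('h \<times> 'h) list"
  ribbon :: "'h"

definition k_algebra :: "('k::field \<Rightarrow> 'h::ring_1 \<Rightarrow> 'h) \<Rightarrow> bool" where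
  "k_algebra sc \<longleftrightarrow> vector_space sc \<and>
     (\<forall>c x y. sc c x * y = sc c (x * y) \<and> x * sc c y = sc c (x * y))"

definition bialgebra :: "('k::field, 'h::ring_1) hopf_data \<Rightarrow> bool" where
  "bialgebra H \<longleftrightarrow>
     k_algebra (scal H) \<and>
     (\<forall>x y. tensor2_eq (scal H) (comul H (x + y)) (comul H x @ comul H y)) \<and>
     (\<forall>c x. tensor2_eq (scal H) (comul H (scal H c x)) [(scal H c a, b). (a, b) \<leftarrow> comul H x]) \<and>
     Vector_Spaces.linear (scal H) (*) (counit H) \<and>
     (\<forall>x. tensor3_eq (scal H)
        [(a, b, c). (y, c) \<leftarrow> comul H x, (a, b) \<leftarrow> comul H y]
        [(a, b, c). (a, y) \<leftarrow> comul H x, (b, c) \<leftarrow> comul H y]) \<and>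
     (\<forall>x. (\<Sum>(a, b)\<leftarrow>comul H x. scal H (counit H a) b) = x) \<and>
     (\<forall>x. (\<Sum>(a, b)\<leftarrow>comul H x. scal H (counit H b) a) = x) \<and>
     (\<forall>x y. tensor2_eq (scal H) (comul H (x * y)) (tensor_mult (comul H x) (comul H y))) \<and>
     tensor2_eq (scal H) (comul H 1) [(1, 1)] \<and>
     (\<forall>x y. counit H (x * y) = counit H x * counit H y) \<and>
     counit H 1 = 1"

definition hopf_algebra :: "('k::field, 'h::ring_1) hopf_data \<Rightarrow> bool" where
  "hopf_algebra H \<longleftrightarrow>
     bialgebra H \<and>
     Vector_Spaces.linear (scal H) (scal H) (antipode H) \<and>
     (\<forall>x. (\<Sum>(a, b)\<leftarrow>comul H x. antipode H a * b) = scal H (counit H x) 1) \<and>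
     (\<forall>x. (\<Sum>(a, b)\<leftarrow>comul H x. a * antipode H b) = scal H (counit H x) 1)"

definition quasitriangular :: "('k::field, 'h::ring_1) hopf_data \<Rightarrow> bool" where
  "quasitriangular H \<longleftrightarrow>
     hopf_algebra H \<and>
     (\<exists>Q. tensor2_eq (scal H) (tensor_mult (Rmat H) Q) [(1, 1)] \<and>
          tensor2_eq (scal H) (tensor_mult Q (Rmat H)) [(1, 1)]) \<and>
     (\<forall>x. tensor2_eq (scal H)
        (tensor_mult (tensor_swap (comul H x)) (Rmat H)) (tensor_mult (Rmat H) (comul H x))) \<and>
     \<comment> \<open>\<open>(\<Delta> \<otimes> id) R = R\<^sub>1\<^sub>3 R\<^sub>2\<^sub>3\<close> and \<open>(id \<otimes> \<Delta>) R = R\<^sub>1\<^sub>3 R\<^sub>1\<^sub>2\<close>\<close>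
     tensor3_eq (scal H)
        [(a1, a2, b). (a, b) \<leftarrow> Rmat H, (a1, a2) \<leftarrow> comul H a]
        [(a, a', b * b'). (a, b) \<leftarrow> Rmat H, (a', b') \<leftarrow> Rmat H] \<and>
     tensor3_eq (scal H)
        [(a, b1, b2). (a, b) \<leftarrow> Rmat H, (b1, b2) \<leftarrow> comul H b]
        [(a * a', b', b). (a, b) \<leftarrow> Rmat H, (a', b') \<leftarrow> Rmat H]"

definition drinfeld_element :: "('k::field, 'h::ring_1) hopf_data \<Rightarrow> 'h" where
  "drinfeld_element H = (\<Sum>(a, b)\<leftarrow>Rmat H. antipode H b * a)"

text \<open>
  The ribbon element \<open>v\<close> satisfies \<open>\<Delta> v = (R\<^sub>2\<^sub>1 R)\<^sup>-\<^sup>1 (v \<otimes> v)\<close>, written below without the inverse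
  of the (invertible) tensor \<open>R\<^sub>2\<^sub>1 R\<close>.
\<close>

definition ribbon_hopf_algebra :: "('k::field, 'h::ring_1) hopf_data \<Rightarrow> bool" where
  "ribbon_hopf_algebra H \<longleftrightarrow>
     quasitriangular H \<and>
     (\<forall>x. ribbon H * x = x * ribbon H) \<and>
     (\<exists>w. ribbon H * w = 1 \<and> w * ribbon H = 1) \<and>
     ribbon H * ribbon H = drinfeld_element H * antipode H (drinfeld_element H) \<and>
     antipode H (ribbon H) = ribbon H \<and>
     counit H (ribbon H) = 1 \<and>
     tensor2_eq (scal H)
       (tensor_mult (tensor_mult (tensor_swap (Rmat H)) (Rmat H)) (comul H (ribbon H)))
       [(ribbon H, ribbon H)]"

definition ribbon_inv :: "('k::field, 'h::ring_1) hopf_data \<Rightarrow> 'h" where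
  "ribbon_inv H = (THE w. ribbon H * w = 1 \<and> w * ribbon H = 1)"


section \<open>Finite dimensional modules\<close>

definition fd_module ::
  "('k::field, 'h::ring_1) hopf_data \<Rightarrow> ('k \<Rightarrow> 'v::ab_group_add \<Rightarrow> 'v) \<Rightarrow> ('h \<Rightarrow> 'v \<Rightarrow> 'v) \<Rightarrow> bool" where
  "fd_module H sv act \<longleftrightarrow>
     (\<exists>B. finite_dimensional_vector_space sv B) \<and>
     (\<forall>h. Vector_Spaces.linear sv sv (act h)) \<and>
     (\<forall>x. act 1 x = x) \<and>
     (\<forall>g h x. act (g * h) x = act g (act h x)) \<and>
     (\<forall>g h x. act (g + h) x = act g x + act h x) \<and>
     (\<forall>c h x. act (scal H c h) x = sv c (act h x))"

text \<open>
  The category \<open>H\<close>-mod is used in its strict form: an object is a finite dimensional module with an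
  ordered basis, i.e. a dimension together with a matrix representation, and a morphism is an
  intertwining matrix (acting on column vectors).  Tensor products carry the lexicographically
  ordered product basis, so they are Kronecker products and the associativity and unit constraints
  are identity matrices; duals carry the dual basis.
\<close>

record ('k, 'h) mat_module =
  mdim :: nat
  mact :: "'h \<Rightarrow> 'k mat"

definition is_mat_module :: "('k::field, 'h::ring_1) hopf_data \<Rightarrow> ('k, 'h) mat_module \<Rightarrow> bool" where
  "is_mat_module H M \<longleftrightarrow>
     (\<forall>h. mact M h \<in> carrier_mat (mdim M) (mdim M)) \<and>
     mact M 1 = 1\<^sub>m (mdim M) \<and>
     (\<forall>g h. mact M (g * h) = mact M g * mact M h) \<and>
     (\<forall>g h. mact M (g + h) = mact M g + mact M h) \<and>
     (\<forall>c h. mact M (scal H c h) = c \<cdot>\<^sub>m mact M h)"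

definition module_hom_mat :: "('k::field, 'h) mat_module \<Rightarrow> ('k, 'h) mat_module \<Rightarrow> 'k mat set" where
  "module_hom_mat M N =
     {f \<in> carrier_mat (mdim N) (mdim M). \<forall>h. f * mact M h = mact N h * f}"

definition ordered_basis :: "('k::field \<Rightarrow> 'v::ab_group_add \<Rightarrow> 'v) \<Rightarrow> 'v list \<Rightarrow> bool" where
  "ordered_basis sv bs \<longleftrightarrow> distinct bs \<and> finite_dimensional_vector_space sv (set bs)"

definition coordinate_module ::
  "('k::field \<Rightarrow> 'v::ab_group_add \<Rightarrow> 'v) \<Rightarrow> ('h \<Rightarrow> 'v \<Rightarrow> 'v) \<Rightarrow> 'v list \<Rightarrow> ('k, 'h) mat_module" where
  "coordinate_module sv act bs =
     \<lparr>mdim = length bs,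
      mact = (\<lambda>h. mat (length bs) (length bs)
        (\<lambda>(i, j). Modules.module.representation sv (set bs) (act h (bs ! j)) (bs ! i)))\<rparr>"

definition kron :: "'k::semiring_0 mat \<Rightarrow> 'k mat \<Rightarrow> 'k mat" where
  "kron A B = mat (dim_row A * dim_row B) (dim_col A * dim_col B)
     (\<lambda>(i, j). A $$ (i div dim_row B, j div dim_col B) * B $$ (i mod dim_row B, j mod dim_col B))"

text \<open>The action of a tensor in \<open>H \<otimes> H\<close> on the tensor product of the vector spaces of \<open>M\<close> and \<open>N\<close>.\<close>

definition tensor_act ::
  "('h \<times> 'h) list \<Rightarrow> ('k::field, 'h) mat_module \<Rightarrow> ('k, 'h) mat_module \<Rightarrow> 'k mat" where
  "tensor_act X M N = mat (mdim M * mdim N) (mdim M * mdim N)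
     (\<lambda>ij. \<Sum>(a, b)\<leftarrow>X. kron (mact M a) (mact N b) $$ ij)"

definition unit_module :: "('k::field, 'h) hopf_data \<Rightarrow> ('k, 'h) mat_module" where
  "unit_module H = \<lparr>mdim = 1, mact = (\<lambda>h. mat 1 1 (\<lambda>_. counit H h))\<rparr>"

definition tensor_module ::
  "('k::field, 'h) hopf_data \<Rightarrow> ('k, 'h) mat_module \<Rightarrow> ('k, 'h) mat_module \<Rightarrow> ('k, 'h) mat_module" where
  "tensor_module H M N =
     \<lparr>mdim = mdim M * mdim N, mact = (\<lambda>h. tensor_act (comul H h) M N)\<rparr>"

definition dual_module :: "('k::field, 'h) hopf_data \<Rightarrow> ('k, 'h) mat_module \<Rightarrow> ('k, 'h) mat_module" where
  "dual_module H M = \<lparr>mdim = mdim M, mact = (\<lambda>h. transpose_mat (mact M (antipode H h)))\<rparr>"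

text \<open>Evaluation \<open>M\<^sup>* \<otimes> M \<rightarrow> k\<close> and coevaluation \<open>k \<rightarrow> M \<otimes> M\<^sup>*\<close>.\<close>

definition ev :: "('k::field, 'h) mat_module \<Rightarrow> 'k mat" where
  "ev M = mat 1 (mdim M * mdim M) (\<lambda>(_, j). if j div mdim M = j mod mdim M then 1 else 0)"

definition coev :: "('k::field, 'h) mat_module \<Rightarrow> 'k mat" where
  "coev M = mat (mdim M * mdim M) 1 (\<lambda>(i, _). if i div mdim M = i mod mdim M then 1 else 0)"

text \<open>The flip \<open>k\<^sup>m \<otimes> k\<^sup>n \<rightarrow> k\<^sup>n \<otimes> k\<^sup>m\<close>.\<close>

definition flip_mat :: "nat \<Rightarrow> nat \<Rightarrow> 'k::field mat" where
  "flip_mat m n = mat (n * m) (m * n)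
     (\<lambda>(i, j). if i div m = j mod n \<and> i mod m = j div n then 1 else 0)"

definition braiding ::
  "('k::field, 'h) hopf_data \<Rightarrow> ('k, 'h) mat_module \<Rightarrow> ('k, 'h) mat_module \<Rightarrow> 'k mat" where
  "braiding H M N = flip_mat (mdim M) (mdim N) * tensor_act (Rmat H) M N"

definition twist :: "('k::field, 'h::ring_1) hopf_data \<Rightarrow> ('k, 'h) mat_module \<Rightarrow> 'k mat" where
  "twist H M = mact M (ribbon_inv H)"


section \<open>Classical and virtual framed oriented tangles\<close>

datatype sgn = Plus | Minus

fun opp :: "sgn \<Rightarrow> sgn" where
  "opp Plus = Minus"
| "opp Minus = Plus"

text \<open>
  Diagrams are read from bottom to top: \<open>Comp D E\<close> is \<open>D \<circ> E\<close> (\<open>D\<close> on top of \<open>E\<close>) and \<open>Tens D E\<close>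
  has \<open>D\<close> to the left of \<open>E\<close>.  In \<open>Pos s t\<close> and \<open>Neg s t\<close>, of type \<open>[s, t] \<rightarrow> [t, s]\<close>, the upper strand
  is the one going from bottom left to top right, respectively from bottom right to top left.  They are
  the positive and negative crossing pictures with any orientation of the two strands.
  \<open>Cap s : [s, opp s] \<rightarrow> []\<close> and \<open>Cup s : [] \<rightarrow> [s, opp s]\<close>.
\<close>

datatype diagram =
    Ident "sgn list"
  | Pos sgn sgn
  | Neg sgn sgn
  | Virt sgn sgn
  | Cap sgn
  | Cup sgn
  | Comp diagram diagram
  | Tens diagram diagram

fun src :: "diagram \<Rightarrow> sgn list" where
  "src (Ident w) = w"
| "src (Pos s t) = [s, t]"
| "src (Neg s t) = [s, t]"
| "src (Virt s t) = [s, t]"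
| "src (Cap s) = [s, opp s]"
| "src (Cup s) = []"
| "src (Comp D E) = src E"
| "src (Tens D E) = src D @ src E"

fun tgt :: "diagram \<Rightarrow> sgn list" where
  "tgt (Ident w) = w"
| "tgt (Pos s t) = [t, s]"
| "tgt (Neg s t) = [t, s]"
| "tgt (Virt s t) = [t, s]"
| "tgt (Cap s) = []"
| "tgt (Cup s) = [s, opp s]"
| "tgt (Comp D E) = tgt D"
| "tgt (Tens D E) = tgt D @ tgt E"

fun wf_diagram :: "diagram \<Rightarrow> bool" where
  "wf_diagram (Comp D E) \<longleftrightarrow> wf_diagram D \<and> wf_diagram E \<and> src D = tgt E"
| "wf_diagram (Tens D E) \<longleftrightarrow> wf_diagram D \<and> wf_diagram E"
| "wf_diagram _ \<longleftrightarrow> True"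

fun classical :: "diagram \<Rightarrow> bool" where
  "classical (Virt s t) \<longleftrightarrow> False"
| "classical (Comp D E) \<longleftrightarrow> classical D \<and> classical E"
| "classical (Tens D E) \<longleftrightarrow> classical D \<and> classical E"
| "classical _ \<longleftrightarrow> True"

abbreviation strand :: "sgn \<Rightarrow> diagram" where
  "strand s \<equiv> Ident [s]"

inductive monoidal_move :: "diagram \<Rightarrow> diagram \<Rightarrow> bool" where
  "monoidal_move (Comp (Comp D E) F) (Comp D (Comp E F))"
| "monoidal_move (Comp (Ident (tgt D)) D) D"
| "monoidal_move (Comp D (Ident (src D))) D"
| "monoidal_move (Tens (Tens D E) F) (Tens D (Tens E F))"
| "monoidal_move (Tens (Ident []) D) D"
| "monoidal_move (Tens D (Ident [])) D"
| "monoidal_move (Tens (Ident u) (Ident w)) (Ident (u @ w))"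
| "monoidal_move (Comp (Tens D E) (Tens D' E')) (Tens (Comp D D') (Comp E E'))"

text \<open>
  Planar isotopy of diagrams in general position with respect to the height function: apart from the
  interchange law above, extrema cancel, and a crossing slides over a maximum or a minimum of
  one of its two strands.  The slide rotates the crossing, so \<open>Pos\<close> and \<open>Neg\<close> are exchanged.
\<close>

inductive planar_move :: "diagram \<Rightarrow> diagram \<Rightarrow> bool" where
  "planar_move (Comp (Tens (Cap s) (strand s)) (Tens (strand s) (Cup (opp s)))) (strand s)"
| "planar_move (Comp (Tens (strand s) (Cap (opp s))) (Tens (Cup s) (strand s))) (strand s)"
| "planar_move (Comp (Tens (Cap s) (strand t)) (Tens (strand s) (Pos t (opp s))))
               (Comp (Tens (strand t) (Cap s)) (Tens (Neg s t) (strand (opp s))))"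
| "planar_move (Comp (Tens (Cap s) (strand t)) (Tens (strand s) (Neg t (opp s))))
               (Comp (Tens (strand t) (Cap s)) (Tens (Pos s t) (strand (opp s))))"
| "planar_move (Comp (Tens (strand s) (Pos (opp s) t)) (Tens (Cup s) (strand t)))
               (Comp (Tens (Neg t s) (strand (opp s))) (Tens (strand t) (Cup s)))"
| "planar_move (Comp (Tens (strand s) (Neg (opp s) t)) (Tens (Cup s) (strand t)))
               (Comp (Tens (Pos t s) (strand (opp s))) (Tens (strand t) (Cup s)))"

inductive virtual_planar_move :: "diagram \<Rightarrow> diagram \<Rightarrow> bool" where
  "virtual_planar_move (Comp (Tens (Cap s) (strand t)) (Tens (strand s) (Virt t (opp s))))
                       (Comp (Tens (strand t) (Cap s)) (Tens (Virt s t) (strand (opp s))))"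
| "virtual_planar_move (Comp (Tens (strand s) (Virt (opp s) t)) (Tens (Cup s) (strand t)))
                       (Comp (Tens (Virt t s) (strand (opp s))) (Tens (strand t) (Cup s)))"

definition right_kink :: "(sgn \<Rightarrow> sgn \<Rightarrow> diagram) \<Rightarrow> sgn \<Rightarrow> diagram" where
  "right_kink X s =
     Comp (Tens (strand s) (Cap s))
       (Comp (Tens (X s s) (strand (opp s))) (Tens (strand s) (Cup s)))"

definition left_kink :: "(sgn \<Rightarrow> sgn \<Rightarrow> diagram) \<Rightarrow> sgn \<Rightarrow> diagram" where
  "left_kink X s =
     Comp (Tens (Cap (opp s)) (strand s))
       (Comp (Tens (strand (opp s)) (X s s)) (Tens (Cup (opp s)) (strand s)))"

text \<open>
  The framing is the blackboard framing.  In the framed version of the first Reidemeister move, kinks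
  with the same crossing but opposite direction of rotation are identified.
\<close>

inductive reidemeister_move :: "diagram \<Rightarrow> diagram \<Rightarrow> bool" where
  "reidemeister_move (right_kink Pos s) (left_kink Pos s)"
| "reidemeister_move (right_kink Neg s) (left_kink Neg s)"
| "reidemeister_move (Comp (Neg t s) (Pos s t)) (Ident [s, t])"
| "reidemeister_move (Comp (Pos t s) (Neg s t)) (Ident [s, t])"
| "reidemeister_move
     (Comp (Tens (Pos t u) (strand s)) (Comp (Tens (strand t) (Pos s u)) (Tens (Pos s t) (strand u))))
     (Comp (Tens (strand u) (Pos s t)) (Comp (Tens (Pos s u) (strand t)) (Tens (strand s) (Pos t u))))"

text \<open>
  A virtual kink is not trivial: the tangles are rotational.  The analogue of the mixed relation for
  \<open>Neg\<close> follows from the one for \<open>Pos\<close>.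
\<close>

inductive virtual_move :: "diagram \<Rightarrow> diagram \<Rightarrow> bool" where
  "virtual_move (Comp (Virt t s) (Virt s t)) (Ident [s, t])"
| "virtual_move
     (Comp (Tens (Virt t u) (strand s)) (Comp (Tens (strand t) (Virt s u)) (Tens (Virt s t) (strand u))))
     (Comp (Tens (strand u) (Virt s t)) (Comp (Tens (Virt s u) (strand t)) (Tens (strand s) (Virt t u))))"
| "virtual_move
     (Comp (Tens (Virt t u) (strand s)) (Comp (Tens (strand t) (Pos s u)) (Tens (Virt s t) (strand u))))
     (Comp (Tens (strand u) (Virt s t)) (Comp (Tens (Pos s u) (strand t)) (Tens (strand s) (Virt t u))))"

inductive diagram_cong ::
  "(diagram \<Rightarrow> bool) \<Rightarrow> (diagram \<Rightarrow> diagram \<Rightarrow> bool) \<Rightarrow> diagram \<Rightarrow> diagram \<Rightarrow> bool"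
  for A :: "diagram \<Rightarrow> bool" and M :: "diagram \<Rightarrow> diagram \<Rightarrow> bool" where
  move: "\<lbrakk>M D E; wf_diagram D; wf_diagram E; A D; A E\<rbrakk> \<Longrightarrow> diagram_cong A M D E"
| refl: "\<lbrakk>wf_diagram D; A D\<rbrakk> \<Longrightarrow> diagram_cong A M D D"
| sym: "diagram_cong A M D E \<Longrightarrow> diagram_cong A M E D"
| trans: "\<lbrakk>diagram_cong A M D E; diagram_cong A M E F\<rbrakk> \<Longrightarrow> diagram_cong A M D F"
| Comp: "\<lbrakk>diagram_cong A M D D'; diagram_cong A M E E'; src D = tgt E\<rbrakk> \<Longrightarrow>
    diagram_cong A M (Comp D E) (Comp D' E')"
| Tens: "\<lbrakk>diagram_cong A M D D'; diagram_cong A M E E'\<rbrakk> \<Longrightarrow>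
    diagram_cong A M (Tens D E) (Tens D' E')"

text \<open>
  By Reidemeister's theorem, isotopy classes of framed oriented tangles are the classes of diagrams
  without virtual crossings under \<open>tangle_eq\<close>, where only such diagrams occur as intermediate steps.
\<close>

definition tangle_eq :: "(diagram \<times> diagram) set" where
  "tangle_eq = {(D, E). diagram_cong classical
     (\<lambda>D E. monoidal_move D E \<or> planar_move D E \<or> reidemeister_move D E) D E}"

definition virtual_tangle_eq :: "(diagram \<times> diagram) set" where
  "virtual_tangle_eq = {(D, E). diagram_cong (\<lambda>_. True)
     (\<lambda>D E. monoidal_move D E \<or> planar_move D E \<or> virtual_planar_move D E \<or>
            reidemeister_move D E \<or> virtual_move D E) D E}"

definition tangles :: "sgn list \<Rightarrow> sgn list \<Rightarrow> diagram set set" where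
  "tangles u w = {D. wf_diagram D \<and> classical D \<and> src D = u \<and> tgt D = w} // tangle_eq"

definition virtual_tangles :: "sgn list \<Rightarrow> sgn list \<Rightarrow> diagram set set" where
  "virtual_tangles u w = {D. wf_diagram D \<and> src D = u \<and> tgt D = w} // virtual_tangle_eq"

abbreviation framed_links :: "diagram set set" where
  "framed_links \<equiv> tangles [] []"

abbreviation framed_virtual_links :: "diagram set set" where
  "framed_virtual_links \<equiv> virtual_tangles [] []"

text \<open>
  A classical tangle regarded as a virtual one: the virtual class of any of its diagrams.  Since
  \<open>tangle_eq\<close> refines \<open>virtual_tangle_eq\<close>, the image of the whole class is a single virtual class.
\<close>

definition as_virtual :: "diagram set \<Rightarrow> diagram set" where
  "as_virtual L = virtual_tangle_eq `` L"

definition tangle_class :: "diagram \<Rightarrow> diagram set" where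
  "tangle_class D = tangle_eq `` {D}"


section \<open>The Reshetikhin--Turaev functor\<close>

text \<open>
  Objects of the ribbon category of tangles: \<open>None\<close> is the empty word and \<open>Some a\<close> a nonempty
  parenthesised word, so that \<open>pmult\<close> makes this the free non-associative monoid on the two signs.
\<close>

datatype ptree = Letter sgn | Bracket ptree ptree

type_synonym pword = "ptree option"

fun pmult :: "pword \<Rightarrow> pword \<Rightarrow> pword" where
  "pmult None w = w"
| "pmult (Some a) None = Some a"
| "pmult (Some a) (Some b) = Some (Bracket a b)"

fun letters :: "ptree \<Rightarrow> sgn list" where
  "letters (Letter s) = [s]"
| "letters (Bracket a b) = letters a @ letters b"

fun flatten :: "pword \<Rightarrow> sgn list" where
  "flatten None = []"
| "flatten (Some a) = letters a"

text \<open>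
  The braiding \<open>u @ w \<rightarrow> w @ u\<close> of tangles, in which the strands of \<open>u\<close> pass over those of \<open>w\<close>, and the
  twist of a word, a full positive turn of the ribbons.
\<close>

fun strand_braid :: "sgn \<Rightarrow> sgn list \<Rightarrow> diagram" where
  "strand_braid s [] = strand s"
| "strand_braid s (t # w) = Comp (Tens (strand t) (strand_braid s w)) (Tens (Pos s t) (Ident w))"

fun word_braid :: "sgn list \<Rightarrow> sgn list \<Rightarrow> diagram" where
  "word_braid [] w = Ident w"
| "word_braid (s # u) w = Comp (Tens (strand_braid s w) (Ident u)) (Tens (strand s) (word_braid u w))"

fun word_twist :: "sgn list \<Rightarrow> diagram" where
  "word_twist [] = Ident []"
| "word_twist (s # u) =
     Comp (word_braid u [s]) (Comp (word_braid [s] u) (Tens (right_kink Pos s) (word_twist u)))"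

text \<open>
  \<open>rt_functor H V Fo Fm\<close>: \<open>(Fo, Fm)\<close> is a strict monoidal functor from parenthesised framed tangles to
  \<open>H\<close>-mod that preserves the braiding and the ribbon structure (the twist, and the duality between
  \<open>Plus\<close> and \<open>Minus\<close>), with \<open>Fo\<close> sending the two signs to \<open>V\<close> and its dual.  \<open>Fm u w\<close> is the action on
  the morphisms \<open>u \<rightarrow> w\<close>.  Strictness includes preservation of the associativity constraints.
\<close>

definition rt_functor ::
  "('k::field, 'h::ring_1) hopf_data \<Rightarrow> ('k, 'h) mat_module \<Rightarrow>
   (pword \<Rightarrow> ('k, 'h) mat_module) \<Rightarrow> (pword \<Rightarrow> pword \<Rightarrow> diagram set \<Rightarrow> 'k mat) \<Rightarrow> bool" where
  "rt_functor H V Fo Fm \<longleftrightarrow>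
     (\<forall>w. is_mat_module H (Fo w)) \<and>
     (\<forall>u w. \<forall>L \<in> tangles (flatten u) (flatten w). Fm u w L \<in> module_hom_mat (Fo u) (Fo w)) \<and>
     (\<forall>w. Fm w w (tangle_class (Ident (flatten w))) = 1\<^sub>m (mdim (Fo w))) \<and>
     (\<forall>u w x D E. wf_diagram (Comp D E) \<and> classical (Comp D E) \<and>
        src E = flatten u \<and> tgt E = flatten w \<and> tgt D = flatten x \<longrightarrow>
        Fm u x (tangle_class (Comp D E)) = Fm w x (tangle_class D) * Fm u w (tangle_class E)) \<and>
     Fo None = unit_module H \<and>
     (\<forall>u w. Fo (pmult u w) = tensor_module H (Fo u) (Fo w)) \<and>
     (\<forall>u w u' w' D E. wf_diagram (Tens D E) \<and> classical (Tens D E) \<and>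
        src D = flatten u \<and> tgt D = flatten w \<and> src E = flatten u' \<and> tgt E = flatten w' \<longrightarrow>
        Fm (pmult u u') (pmult w w') (tangle_class (Tens D E)) =
          kron (Fm u w (tangle_class D)) (Fm u' w' (tangle_class E))) \<and>
     (\<forall>u w x. Fm (pmult (pmult u w) x) (pmult u (pmult w x))
          (tangle_class (Ident (flatten u @ flatten w @ flatten x))) =
        1\<^sub>m (mdim (Fo u) * mdim (Fo w) * mdim (Fo x))) \<and>
     (\<forall>u w. Fm (pmult u w) (pmult w u) (tangle_class (word_braid (flatten u) (flatten w))) =
        braiding H (Fo u) (Fo w)) \<and>
     (\<forall>w. Fm w w (tangle_class (word_twist (flatten w))) = twist H (Fo w)) \<and>
     Fm (Some (Bracket (Letter Minus) (Letter Plus))) None (tangle_class (Cap Minus)) = ev V \<and>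
     Fm None (Some (Bracket (Letter Plus) (Letter Minus))) (tangle_class (Cup Plus)) = coev V \<and>
     Fo (Some (Letter Plus)) = V \<and>
     Fo (Some (Letter Minus)) = dual_module H V"

text \<open>
  The functor is unique up to its values outside the morphism sets, and the value on a link,
  a \<open>1 \<times> 1\<close> matrix, does not depend on the basis through which \<open>V\<close> is regarded as an object of \<open>H\<close>-mod.
\<close>

definition reshetikhin_turaev ::
  "('k::field, 'h::ring_1) hopf_data \<Rightarrow> ('k \<Rightarrow> 'v::ab_group_add \<Rightarrow> 'v) \<Rightarrow> ('h \<Rightarrow> 'v \<Rightarrow> 'v) \<Rightarrow>
   diagram set \<Rightarrow> 'k" where
  "reshetikhin_turaev H sv act L =
     (THE c. \<exists>bs Fo Fm. ordered_basis sv bs \<and>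
        rt_functor H (coordinate_module sv act bs) Fo Fm \<and> c = Fm None None L $$ (0, 0))"

end

theory Submission
  imports Defs
begin

text \<open>
  The flip of vector spaces is symmetric and natural with respect to all linear maps, not only the
  \<open>H\<close>-linear ones.  Hence sending virtual crossings to the flip, while classical crossings, caps and
  cups keep their values under a functor defining the Reshetikhin--Turaev invariant, respects every
  virtual, mixed and virtual planar move; naturality with respect to \<open>R\<close>-matrices, evaluations
  and coevaluations is all that these moves ask for.  The classical moves hold because the given
  functor is defined on isotopy classes of tangles.
\<close>

section \<open>Kronecker products and the flip\<close>

lemma mult_add_less:
  fixes i j m n :: nat
  assumes "i < m" "j < n"
  shows "i * n + j < m * n"
proof -
  have "i * n + j < (i + 1) * n" using assms(2) by simp
  also have "\<dots> \<le> m * n" using assms(1) by (intro mult_right_mono) auto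
  finally show ?thesis .
qed

lemma mod_less_of_less_mult: "i mod n < n" if "i < m * n" for i m n :: nat
  using that by (cases n) auto

lemma less_mult_cases:
  fixes i m n :: nat
  assumes "i < m * n"
  obtains a b where "a < m" "b < n" "i = a * n + b"
  using that[of "i div n" "i mod n"] assms
  by (simp add: less_mult_imp_div_less mod_less_of_less_mult)

lemma mult_add_eq_iff:
  fixes a b c d n :: nat
  assumes "b < n" "d < n"
  shows "a * n + b = c * n + d \<longleftrightarrow> a = c \<and> b = d"
proof
  assume eq: "a * n + b = c * n + d"
  have "(a * n + b) div n = a" "(c * n + d) div n = c" using assms by auto
  then have "a = c" using eq by simp
  then show "a = c \<and> b = d" using eq by simp
qed simp

text \<open>The matrix products below sum over a product basis; splitting the middle index into its
  two coordinates makes those sums factor or collapse.\<close>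

lemma sum_mult_index:
  fixes f :: "nat \<Rightarrow> 'a::comm_monoid_add"
  shows "(\<Sum>k<m * n. f k) = (\<Sum>a<m. \<Sum>b<n. f (a * n + b))"
proof -
  have "(\<Sum>a<m. \<Sum>b<n. f (a * n + b)) = (\<Sum>(a, b)\<in>{..<m} \<times> {..<n}. f (a * n + b))"
    by (simp add: sum.cartesian_product)
  also have "\<dots> = (\<Sum>k<m * n. f k)"
    by (rule sum.reindex_bij_witness[where i = "\<lambda>k. (k div n, k mod n)" and j = "\<lambda>(a, b). a * n + b"])
       (auto simp: mult_add_less less_mult_imp_div_less mod_less_of_less_mult)
  finally show ?thesis by simp
qed

section \<open>Kronecker products as a strict monoidal structure\<close>

lemma kron_carrier [intro]:
  "A \<in> carrier_mat a b \<Longrightarrow> B \<in> carrier_mat c d \<Longrightarrow> kron A B \<in> carrier_mat (a * c) (b * d)"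
  by (simp add: kron_def)

lemma dim_kron [simp]:
  "dim_row (kron A B) = dim_row A * dim_row B" "dim_col (kron A B) = dim_col A * dim_col B"
  by (simp_all add: kron_def)

lemma kron_index:
  assumes "i < dim_row A" "k < dim_row B" "j < dim_col A" "l < dim_col B"
  shows "kron A B $$ (i * dim_row B + k, j * dim_col B + l) = A $$ (i, j) * B $$ (k, l)"
  using assms by (simp add: kron_def mult_add_less)

lemma kron_one: "kron (1\<^sub>m m) (1\<^sub>m n) = (1\<^sub>m (m * n) :: 'k::semiring_1 mat)"
proof (rule eq_matI)
  fix i j assume "i < dim_row (1\<^sub>m (m * n) :: 'k mat)" "j < dim_col (1\<^sub>m (m * n) :: 'k mat)"
  then have ij: "i < m * n" "j < m * n" by auto
  have "i = j \<longleftrightarrow> i div n = j div n \<and> i mod n = j mod n"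
    by (metis div_mult_mod_eq)
  then show "kron (1\<^sub>m m) (1\<^sub>m n) $$ (i, j) = (1\<^sub>m (m * n) :: 'k mat) $$ (i, j)"
    using ij by (auto simp: kron_def less_mult_imp_div_less mod_less_of_less_mult)
qed auto

text \<open>The simplifier turns the dimension \<open>1\<close> into \<open>Suc 0\<close>, hence the
  form of these unit laws and of the carriers of caps and cups below.\<close>

lemma kron_one_left [simp]: "kron (1\<^sub>m (Suc 0)) A = (A :: 'k::semiring_1 mat)"
  by (rule eq_matI) (auto simp: kron_def)

lemma kron_one_right [simp]: "kron A (1\<^sub>m (Suc 0)) = (A :: 'k::semiring_1 mat)"
  by (rule eq_matI) (auto simp: kron_def)

lemma kron_assoc:
  fixes A B C :: "'k::semiring_0 mat"
  shows "kron (kron A B) C = kron A (kron B C)"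
proof (rule eq_matI)
  fix i j assume "i < dim_row (kron A (kron B C))" "j < dim_col (kron A (kron B C))"
  then have "i < (dim_row A * dim_row B) * dim_row C" "j < (dim_col A * dim_col B) * dim_col C"
    by (simp_all add: mult.assoc)
  then obtain i1 i2 i3 j1 j2 j3 where
    i: "i1 < dim_row A" "i2 < dim_row B" "i3 < dim_row C" "i = (i1 * dim_row B + i2) * dim_row C + i3" and
    j: "j1 < dim_col A" "j2 < dim_col B" "j3 < dim_col C" "j = (j1 * dim_col B + j2) * dim_col C + j3"
    by (metis less_mult_cases)
  have i': "i = i1 * dim_row (kron B C) + (i2 * dim_row C + i3)"
    and j': "j = j1 * dim_col (kron B C) + (j2 * dim_col C + j3)"
    using i j by (simp_all add: algebra_simps)
  have "kron (kron A B) C $$ (i, j) = (A $$ (i1, j1) * B $$ (i2, j2)) * C $$ (i3, j3)"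
    using i j kron_index[of "i1 * dim_row B + i2" "kron A B" i3 C "j1 * dim_col B + j2" j3]
    by (simp add: mult_add_less kron_index)
  moreover have "kron A (kron B C) $$ (i, j) = A $$ (i1, j1) * (B $$ (i2, j2) * C $$ (i3, j3))"
    unfolding i' j'
    by (subst kron_index) (use i j in \<open>simp_all add: mult_add_less kron_index\<close>)
  ultimately show "kron (kron A B) C $$ (i, j) = kron A (kron B C) $$ (i, j)"
    by (simp add: mult.assoc)
qed (auto simp: mult.assoc)

text \<open>The interchange law: with the middle index split into a pair, the double sum is a
  product of two sums, since the scalars commute.\<close>

lemma kron_mult:
  fixes A B C D :: "'k::comm_semiring_0 mat"
  assumes "dim_col A = dim_row C" "dim_col B = dim_row D"
  shows "kron A B * kron C D = kron (A * C) (B * D)"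
proof (rule eq_matI)
  fix i j assume "i < dim_row (kron (A * C) (B * D))" "j < dim_col (kron (A * C) (B * D))"
  then obtain i1 i2 j1 j2 where
    i: "i1 < dim_row A" "i2 < dim_row B" "i = i1 * dim_row B + i2" and
    j: "j1 < dim_col C" "j2 < dim_col D" "j = j1 * dim_col D + j2"
    by (auto elim!: less_mult_cases)
  let ?f = "\<lambda>a. A $$ (i1, a) * C $$ (a, j1)" and ?g = "\<lambda>b. B $$ (i2, b) * D $$ (b, j2)"
  have ij: "i < dim_row (kron A B)" "j < dim_col (kron C D)"
    using i j by (simp_all add: mult_add_less)
  have "(kron A B * kron C D) $$ (i, j) =
      (\<Sum>k<dim_row C * dim_row D. kron A B $$ (i, k) * kron C D $$ (k, j))"
    using ij assms by (simp add: scalar_prod_def lessThan_atLeast0)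
  also have "\<dots> = (\<Sum>a<dim_row C. \<Sum>b<dim_row D. ?f a * ?g b)"
    unfolding sum_mult_index
  proof (intro sum.cong HOL.refl)
    fix a b assume "a \<in> {..<dim_row C}" "b \<in> {..<dim_row D}"
    then have ab: "a < dim_col A" "b < dim_col B" "a < dim_row C" "b < dim_row D"
      using assms by auto
    show "kron A B $$ (i, a * dim_row D + b) * kron C D $$ (a * dim_row D + b, j) = ?f a * ?g b"
      using kron_index[OF i(1,2) ab(1,2)] kron_index[OF ab(3,4) j(1,2)] i(3) j(3) assms
      by (simp add: mult_ac)
  qed
  also have "\<dots> = (\<Sum>a<dim_row C. ?f a) * (\<Sum>b<dim_row D. ?g b)"
    by (simp add: sum_product)
  also have "\<dots> = (A * C) $$ (i1, j1) * (B * D) $$ (i2, j2)"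
    using i j assms by (simp add: scalar_prod_def lessThan_atLeast0)
  also have "\<dots> = kron (A * C) (B * D) $$ (i, j)"
    using kron_index[of i1 "A * C" i2 "B * D" j1 j2] i j by simp
  finally show "(kron A B * kron C D) $$ (i, j) = kron (A * C) (B * D) $$ (i, j)" .
qed auto

text \<open>Associativity with equations between dimensions instead of carrier sets, so that
  rewriting can discharge the side conditions.\<close>

lemma mat_mult_assoc:
  fixes A B C :: "'k::semiring_0 mat"
  assumes "dim_col A = dim_row B" "dim_col B = dim_row C"
  shows "A * B * C = A * (B * C)"
  by (rule assoc_mult_mat[of A "dim_row A" "dim_row B" B "dim_row C" C "dim_col C"])
     (intro carrier_matI assms HOL.refl)+

section \<open>The flip as a natural symmetry of vector spaces\<close>

lemma flip_carrier [simp, intro]: "flip_mat m n \<in> carrier_mat (n * m) (m * n)"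
  by (simp add: flip_mat_def)

lemma dim_flip [simp]: "dim_row (flip_mat m n) = n * m" "dim_col (flip_mat m n) = m * n"
  by (simp_all add: flip_mat_def)

lemma flip_index:
  assumes "a < m" "b < n" "c < m" "d < n"
  shows "flip_mat m n $$ (b * m + a, c * n + d) = (if a = c \<and> b = d then 1 else 0)"
  using assms mult_add_less[of b n a m] mult_add_less[of c m d n] by (auto simp: flip_mat_def)

text \<open>The flip is a permutation matrix, so multiplication by it on the left permutes
  rows.\<close>

lemma flip_mult_index:
  assumes "X \<in> carrier_mat (m * n) p" "a < m" "b < n" "j < p"
  shows "(flip_mat m n * X) $$ (b * m + a, j) = X $$ (a * n + b, j)"
proof -
  have "(flip_mat m n * X) $$ (b * m + a, j) =
      (\<Sum>k<m * n. flip_mat m n $$ (b * m + a, k) * X $$ (k, j))"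
    using assms mult_add_less[of b n a m] by (simp add: scalar_prod_def lessThan_atLeast0)
  \<comment> \<open>The condition on the pair is written as nested conditionals so that the two sums
    collapse one after the other.\<close>
  also have "\<dots> = (\<Sum>c<m. \<Sum>d<n. if c = a then if d = b then X $$ (a * n + b, j) else 0 else 0)"
    unfolding sum_mult_index using assms by (intro sum.cong HOL.refl) (auto simp: flip_index)
  also have "\<dots> = (\<Sum>c<m. if c = a then \<Sum>d<n. if d = b then X $$ (a * n + b, j) else 0 else 0)"
    by (intro sum.cong HOL.refl) auto
  also have "\<dots> = X $$ (a * n + b, j)"
    using assms by simp
  finally show ?thesis .
qed

lemma mult_flip_index:
  assumes "X \<in> carrier_mat p (n * m)" "a < m" "b < n" "i < p"
  shows "(X * flip_mat m n) $$ (i, a * n + b) = X $$ (i, b * m + a)"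
proof -
  have "(X * flip_mat m n) $$ (i, a * n + b) =
      (\<Sum>k<n * m. X $$ (i, k) * flip_mat m n $$ (k, a * n + b))"
    using assms mult_add_less[of a m b n] by (simp add: scalar_prod_def lessThan_atLeast0)
  also have "\<dots> = (\<Sum>d<n. \<Sum>c<m. if d = b then if c = a then X $$ (i, b * m + a) else 0 else 0)"
    unfolding sum_mult_index using assms by (intro sum.cong HOL.refl) (auto simp: flip_index)
  also have "\<dots> = (\<Sum>d<n. if d = b then \<Sum>c<m. if c = a then X $$ (i, b * m + a) else 0 else 0)"
    by (intro sum.cong HOL.refl) auto
  also have "\<dots> = X $$ (i, b * m + a)"
    using assms by simp
  finally show ?thesis .
qed

text \<open>Both sides have the entry \<open>A $$ (a, c) * B $$ (b, d)\<close>, up to the order of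
  the factors. The matrices are arbitrary, so this applies to caps, cups and crossings
  alike.\<close>

lemma flip_natural:
  fixes A B :: "'k::field mat"
  shows "flip_mat (dim_row A) (dim_row B) * kron A B = kron B A * flip_mat (dim_col A) (dim_col B)"
proof (rule eq_matI)
  fix i j
  assume "i < dim_row (kron B A * flip_mat (dim_col A) (dim_col B))"
    and "j < dim_col (kron B A * flip_mat (dim_col A) (dim_col B))"
  then obtain b a c d where
    i: "b < dim_row B" "a < dim_row A" "i = b * dim_row A + a" and
    j: "c < dim_col A" "d < dim_col B" "j = c * dim_col B + d"
    by (auto elim!: less_mult_cases)
  have "(flip_mat (dim_row A) (dim_row B) * kron A B) $$ (i, j) = kron A B $$ (a * dim_row B + b, j)"
    unfolding i(3) using i j by (intro flip_mult_index) (auto simp: mult_add_less)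
  also have "\<dots> = A $$ (a, c) * B $$ (b, d)"
    unfolding j(3) using i j by (intro kron_index)
  finally have "(flip_mat (dim_row A) (dim_row B) * kron A B) $$ (i, j) = A $$ (a, c) * B $$ (b, d)" .
  moreover have "(kron B A * flip_mat (dim_col A) (dim_col B)) $$ (i, j) =
      kron B A $$ (i, d * dim_col A + c)"
    unfolding j(3) using i j by (intro mult_flip_index) (auto simp: mult_add_less)
  moreover have "\<dots> = B $$ (b, d) * A $$ (a, c)"
    unfolding i(3) using i j by (intro kron_index)
  ultimately show "(flip_mat (dim_row A) (dim_row B) * kron A B) $$ (i, j) =
      (kron B A * flip_mat (dim_col A) (dim_col B)) $$ (i, j)"
    by simp
qed auto

lemma flip_flip: "flip_mat n m * flip_mat m n = (1\<^sub>m (m * n) :: 'k::field mat)"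
proof (rule eq_matI)
  fix i j assume "i < dim_row (1\<^sub>m (m * n) :: 'k mat)" "j < dim_col (1\<^sub>m (m * n) :: 'k mat)"
  then obtain a b c d where
    i: "a < m" "b < n" "i = a * n + b" and j: "c < m" "d < n" "j = c * n + d"
    by (auto elim!: less_mult_cases)
  have "i = j \<longleftrightarrow> a = c \<and> b = d"
    using i j by (simp add: mult_add_eq_iff)
  then show "(flip_mat n m * flip_mat m n :: 'k mat) $$ (i, j) = 1\<^sub>m (m * n) $$ (i, j)"
    using i j flip_mult_index[of "flip_mat m n :: 'k mat" n m "m * n" b a j]
    by (simp add: flip_index mult_add_less)
qed auto

lemma flip_one_left: "flip_mat (Suc 0) n = (1\<^sub>m n :: 'k::field mat)"
  by (rule eq_matI) (auto simp: flip_mat_def)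

lemma flip_one_right: "flip_mat n (Suc 0) = (1\<^sub>m n :: 'k::field mat)"
  by (rule eq_matI) (auto simp: flip_mat_def)

text \<open>A factor of dimension \<open>m\<close> passes two others one at a time: first the one of
  dimension \<open>n\<close>, then the one of dimension \<open>p\<close>.\<close>

lemma flip_hexagon:
  "flip_mat m (n * p) = (kron (1\<^sub>m n) (flip_mat m p) * kron (flip_mat m n) (1\<^sub>m p) :: 'k::field mat)"
    (is "_ = ?L * ?R")
proof (rule eq_matI)
  fix i j assume "i < dim_row (?L * ?R)" "j < dim_col (?L * ?R)"
  then have "i < n * (p * m)" "j < (m * n) * p" by simp_all
  then obtain b c a a' b' c' where
    i: "b < n" "c < p" "a < m" "i = b * (p * m) + (c * m + a)" and
    j: "a' < m" "b' < n" "c' < p" "j = (a' * n + b') * p + c'"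
    by (metis less_mult_cases)
  \<comment> \<open>Row \<open>i\<close> of the permutation matrix \<open>?L\<close> has its only
    nonzero entry in column \<open>b * (m * p) + ?u\<close>, so the sum over the middle index has
    one surviving term.\<close>
  let ?u = "a * p + c"
  have k: "?u < m * p" using i by (simp add: mult_add_less)
  have ij: "i < n * (p * m)" "j < m * n * p"
    using i j by (simp_all add: mult_add_less)
  have "(?L * ?R) $$ (i, j) = (\<Sum>k<n * (m * p). ?L $$ (i, k) * ?R $$ (k, j))"
    using ij by (simp add: scalar_prod_def lessThan_atLeast0 mult.assoc)
  also have "\<dots> = (\<Sum>e<n. \<Sum>f<m * p. if e = b then
      if f = ?u then ?R $$ (b * (m * p) + ?u, j) else 0 else 0)"
    unfolding sum_mult_index[of _ n "m * p"]
  proof (intro sum.cong HOL.refl)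
    fix e f assume ef: "e \<in> {..<n}" "f \<in> {..<m * p}"
    then obtain g h where gh: "g < m" "h < p" "f = g * p + h" by (auto elim!: less_mult_cases)
    have fu: "f = ?u \<longleftrightarrow> g = a \<and> h = c"
      using gh i by (simp add: mult_add_eq_iff)
    have "?L $$ (i, e * (m * p) + f) = (if b = e then if a = g \<and> c = h then 1 else 0 else 0)"
      using ef i gh mult_add_less[of c p a m] mult_add_less[of g m h p]
        kron_index[of b "1\<^sub>m n" "c * m + a" "flip_mat m p :: 'k mat" e f]
      by (simp add: flip_index)
    then show "?L $$ (i, e * (m * p) + f) * ?R $$ (e * (m * p) + f, j) =
        (if e = b then if f = ?u then ?R $$ (b * (m * p) + ?u, j) else 0 else 0)"
      using fu by auto
  qed
  also have "\<dots> = (\<Sum>e<n. if e = b then \<Sum>f<m * p.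
      if f = ?u then ?R $$ (b * (m * p) + ?u, j) else 0 else 0)"
    by (intro sum.cong HOL.refl) auto
  also have "\<dots> = ?R $$ ((b * m + a) * p + c, j)"
    using i k by (simp add: algebra_simps)
  also have "\<dots> = flip_mat m n $$ (b * m + a, a' * n + b') * (1\<^sub>m p) $$ (c, c')"
    using i j kron_index[of "b * m + a" "flip_mat m n :: 'k mat" c "1\<^sub>m p" "a' * n + b'" c']
    by (simp add: mult_add_less)
  also have "\<dots> = (if a = a' \<and> b = b' \<and> c = c' then 1 else 0)"
    using i j by (simp add: flip_index)
  also have "\<dots> = (if a = a' \<and> b * p + c = b' * p + c' then 1 else 0)"
    using i j by (simp add: mult_add_eq_iff)
  also have "\<dots> = flip_mat m (n * p) $$ ((b * p + c) * m + a, a' * (n * p) + (b' * p + c'))"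
    using i j by (subst flip_index) (simp_all add: mult_add_less)
  also have "((b * p + c) * m + a, a' * (n * p) + (b' * p + c')) = (i, j)"
    using i(4) j(4) by (simp add: algebra_simps)
  finally show "flip_mat m (n * p) $$ (i, j) = (?L * ?R) $$ (i, j)" by simp
qed (auto simp: mult_ac)

section \<open>Flips on three equal factors, and maps sliding through them\<close>

lemma flip_kron_square:
  fixes m n :: nat
  shows "kron (flip_mat n n) (1\<^sub>m m) * kron (flip_mat n n) (1\<^sub>m m) = (1\<^sub>m (n * n * m) :: 'k::field mat)"
    and "kron (1\<^sub>m m) (flip_mat n n) * kron (1\<^sub>m m) (flip_mat n n) = (1\<^sub>m (m * (n * n)) :: 'k::field mat)"
  by (simp_all add: kron_mult flip_flip kron_one)

text \<open>This flip is inverse to \<open>flip_mat n (n * n)\<close>, which factors as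
  \<open>?F2 * ?F1\<close>; both factors are involutions, so the inverse is their product in reverse
  order.\<close>

lemma flip_hexagon_inv:
  "flip_mat (n * n) n =
    (kron (flip_mat n n) (1\<^sub>m n) * kron (1\<^sub>m n) (flip_mat n n) :: 'k::field mat)"
proof -
  let ?F1 = "kron (flip_mat n n) (1\<^sub>m n) :: 'k mat"
  let ?F2 = "kron (1\<^sub>m n) (flip_mat n n) :: 'k mat"
  let ?G = "flip_mat (n * n) n :: 'k mat"
  have "?F2 * ?F1 * ?G = 1\<^sub>m (n * n * n)"
    using flip_flip[of n "n * n"] by (simp add: flip_hexagon mult_ac)
  then have "?F1 * (?F2 * (?F2 * ?F1 * ?G)) = ?F1 * ?F2"
    by (simp add: mult_ac)
  also have "?F1 * (?F2 * (?F2 * ?F1 * ?G)) = ?F1 * (?F2 * ?F2) * ?F1 * ?G"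
    by (simp add: mat_mult_assoc mult_ac)
  also have "\<dots> = ?F1 * ?F1 * ?G"
    by (simp add: flip_kron_square mult_ac)
  finally show ?thesis
    by (simp add: flip_kron_square)
qed

text \<open>Naturality of the flip for \<open>C\<close> and an identity, where flipping past the
  one-dimensional space is trivial. Cancelling one involution leaves the slide of a virtual crossing
  over a cap.\<close>

lemma flip_cap:
  fixes C :: "'k::field mat"
  assumes "C \<in> carrier_mat (Suc 0) (n * n)"
  shows "kron C (1\<^sub>m n) * kron (1\<^sub>m n) (flip_mat n n) = kron (1\<^sub>m n) C * kron (flip_mat n n) (1\<^sub>m n)"
proof -
  let ?F1 = "kron (flip_mat n n) (1\<^sub>m n) :: 'k mat"
  let ?F2 = "kron (1\<^sub>m n) (flip_mat n n) :: 'k mat"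
  have C: "dim_row C = Suc 0" "dim_col C = n * n"
    using assms by auto
  have "kron C (1\<^sub>m n) = kron (1\<^sub>m n) C * (?F1 * ?F2)"
    using flip_natural[of C "1\<^sub>m n"] C by (simp add: flip_one_left flip_hexagon_inv)
  then have "kron C (1\<^sub>m n) * ?F2 = kron (1\<^sub>m n) C * (?F1 * (?F2 * ?F2))"
    using C by (simp add: mat_mult_assoc mult_ac)
  then show ?thesis
    by (simp add: flip_kron_square mult_ac)
qed

text \<open>The argument for caps turned upside down, with the one-dimensional space now at the
  source.\<close>

lemma flip_cup:
  fixes C :: "'k::field mat"
  assumes "C \<in> carrier_mat (n * n) (Suc 0)"
  shows "kron (1\<^sub>m n) (flip_mat n n) * kron C (1\<^sub>m n) = kron (flip_mat n n) (1\<^sub>m n) * kron (1\<^sub>m n) C"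
proof -
  let ?F1 = "kron (flip_mat n n) (1\<^sub>m n) :: 'k mat"
  let ?F2 = "kron (1\<^sub>m n) (flip_mat n n) :: 'k mat"
  have C: "dim_row C = n * n" "dim_col C = Suc 0"
    using assms by auto
  have "kron C (1\<^sub>m n) = ?F2 * ?F1 * kron (1\<^sub>m n) C"
    using flip_natural[of "1\<^sub>m n" C] C by (simp add: flip_one_right flip_hexagon)
  then have "?F2 * kron C (1\<^sub>m n) = ?F2 * ?F2 * (?F1 * kron (1\<^sub>m n) C)"
    using C by (simp add: mat_mult_assoc mult_ac)
  then show ?thesis
    using C by (simp add: flip_kron_square mult_ac)
qed

text \<open>The product \<open>?F2 * ?F1\<close> flips one factor past two, and naturality carries
  \<open>C\<close> on the last two factors to \<open>C\<close> on the first two. Multiplying by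
  \<open>?F2\<close> on the left and \<open>?F1\<close> on the right cancels the surplus
  involutions.\<close>

lemma flip_mixed:
  fixes C :: "'k::field mat"
  assumes "C \<in> carrier_mat (n * n) (n * n)"
  shows "kron (flip_mat n n) (1\<^sub>m n) * (kron (1\<^sub>m n) C * kron (flip_mat n n) (1\<^sub>m n)) =
    kron (1\<^sub>m n) (flip_mat n n) * (kron C (1\<^sub>m n) * kron (1\<^sub>m n) (flip_mat n n))"
proof -
  let ?F1 = "kron (flip_mat n n) (1\<^sub>m n) :: 'k mat"
  let ?F2 = "kron (1\<^sub>m n) (flip_mat n n) :: 'k mat"
  have C: "dim_row C = n * n" "dim_col C = n * n"
    using assms by auto
  have nat: "?F2 * ?F1 * kron (1\<^sub>m n) C = kron C (1\<^sub>m n) * (?F2 * ?F1)"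
    using flip_natural[of "1\<^sub>m n" C] C by (simp add: flip_hexagon)
  have "?F2 * (?F2 * ?F1 * kron (1\<^sub>m n) C) * ?F1 = (?F2 * ?F2) * (?F1 * (kron (1\<^sub>m n) C * ?F1))"
    using C by (simp add: mat_mult_assoc mult_ac)
  also have "\<dots> = ?F1 * (kron (1\<^sub>m n) C * ?F1)"
    using C by (simp add: flip_kron_square mult_ac)
  finally have "?F1 * (kron (1\<^sub>m n) C * ?F1) = ?F2 * (kron C (1\<^sub>m n) * (?F2 * ?F1)) * ?F1"
    unfolding nat by simp
  also have "\<dots> = ?F2 * (kron C (1\<^sub>m n) * (?F2 * (?F1 * ?F1)))"
    using C by (simp add: mat_mult_assoc mult_ac)
  also have "\<dots> = ?F2 * (kron C (1\<^sub>m n) * ?F2)"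
    by (simp add: flip_kron_square mult_ac)
  finally show ?thesis .
qed


section \<open>Extending a strict monoidal functor to virtual tangles\<close>

lemma diagram_cong_types:
  assumes "diagram_cong A M D E"
    and "\<And>D E. M D E \<Longrightarrow> wf_diagram D \<Longrightarrow> wf_diagram E \<Longrightarrow> src D = src E \<and> tgt D = tgt E"
  shows "wf_diagram D \<and> wf_diagram E \<and> src D = src E \<and> tgt D = tgt E"
  using assms(1)
proof induction
  case (move D E)
  then show ?case using assms(2)[of D E] by blast
qed simp_all

lemma opp_opp [simp]: "opp (opp s) = s"
  by (cases s) auto

lemma move_types:
  "monoidal_move D E \<Longrightarrow> wf_diagram D \<Longrightarrow> src D = src E \<and> tgt D = tgt E"
  "planar_move D E \<Longrightarrow> src D = src E \<and> tgt D = tgt E"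
  "virtual_planar_move D E \<Longrightarrow> src D = src E \<and> tgt D = tgt E"
  "reidemeister_move D E \<Longrightarrow> src D = src E \<and> tgt D = tgt E"
  "virtual_move D E \<Longrightarrow> src D = src E \<and> tgt D = tgt E"
  by ((erule monoidal_move.cases planar_move.cases virtual_planar_move.cases
        reidemeister_move.cases virtual_move.cases; simp add: right_kink_def left_kink_def)+)

text \<open>Even inside a virtual equivalence these moves relate classical diagrams, so the given
  functor already respects them.\<close>

lemma move_classical:
  "planar_move D E \<Longrightarrow> classical D \<and> classical E"
  "reidemeister_move D E \<Longrightarrow> classical D \<and> classical E"
  by ((erule planar_move.cases reidemeister_move.cases; simp add: right_kink_def left_kink_def)+)

text \<open>What remains of a functor on classical tangles once the modules are forgotten: matrices
  on diagrams, with dimension \<open>n\<close> for both signs.\<close>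

locale tangle_representation =
  fixes n :: nat and J :: "diagram \<Rightarrow> 'k::field mat"
  assumes J_carrier: "wf_diagram D \<Longrightarrow> classical D \<Longrightarrow>
      J D \<in> carrier_mat (n ^ length (tgt D)) (n ^ length (src D))"
    and J_Ident: "J (Ident w) = 1\<^sub>m (n ^ length w)"
    and J_Comp: "wf_diagram (Comp D E) \<Longrightarrow> classical (Comp D E) \<Longrightarrow> J (Comp D E) = J D * J E"
    and J_Tens: "wf_diagram (Tens D E) \<Longrightarrow> classical (Tens D E) \<Longrightarrow> J (Tens D E) = kron (J D) (J E)"
    and J_cong: "(D, E) \<in> tangle_eq \<Longrightarrow> J D = J E"
begin

text \<open>The extension is built on diagrams before any quotient. One flip serves all
  orientations, because a module and its dual have the same dimension.\<close>

fun virtual_rep :: "diagram \<Rightarrow> 'k mat" where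
  "virtual_rep (Virt s t) = flip_mat n n"
| "virtual_rep (Comp D E) = virtual_rep D * virtual_rep E"
| "virtual_rep (Tens D E) = kron (virtual_rep D) (virtual_rep E)"
| "virtual_rep D = J D"

lemma virtual_rep_classical:
  "wf_diagram D \<Longrightarrow> classical D \<Longrightarrow> virtual_rep D = J D"
  by (induction D) (simp_all add: J_Comp J_Tens)

lemma virtual_rep_carrier:
  "wf_diagram D \<Longrightarrow> virtual_rep D \<in> carrier_mat (n ^ length (tgt D)) (n ^ length (src D))"
proof (induction D)
  case (Comp D E)
  then show ?case by (auto intro: mult_carrier_mat)
next
  case (Tens D E)
  then show ?case by (auto simp: power_add)
qed (use J_carrier[of "Ident _"] J_carrier[of "Pos _ _"] J_carrier[of "Neg _ _"]
    J_carrier[of "Cap _"] J_carrier[of "Cup _"] in \<open>simp_all\<close>)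

lemma dim_virtual_rep:
  assumes "wf_diagram D"
  shows "dim_row (virtual_rep D) = n ^ length (tgt D)" "dim_col (virtual_rep D) = n ^ length (src D)"
  using carrier_matD[OF virtual_rep_carrier[OF assms]] by blast+

lemma virtual_rep_move:
  assumes "monoidal_move D E \<or> planar_move D E \<or> virtual_planar_move D E \<or>
      reidemeister_move D E \<or> virtual_move D E"
    and wf: "wf_diagram D" "wf_diagram E"
  shows "virtual_rep D = virtual_rep E"
  using assms(1)
proof (elim disjE)
  \<comment> \<open>These moves may involve virtual crossings inside their subdiagrams, so they are
    checked by matrix algebra and not through \<open>J_cong\<close>.\<close>
  assume "monoidal_move D E"
  then show ?thesis
  proof cases
    case (1 D1 D2 D3)
    then show ?thesis using wf by (simp add: dim_virtual_rep mat_mult_assoc)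
  next
    case 2
    then show ?thesis using wf by (simp add: J_Ident dim_virtual_rep)
  next
    case 3
    then show ?thesis using wf by (simp add: J_Ident dim_virtual_rep)
  next
    case (4 D1 D2 D3)
    then show ?thesis by (simp add: kron_assoc)
  next
    case 5
    then show ?thesis by (simp add: J_Ident)
  next
    case 6
    then show ?thesis by (simp add: J_Ident)
  next
    case (7 u w)
    then show ?thesis by (simp add: J_Ident kron_one power_add)
  next
    case (8 D1 D2 D3 D4)
    \<comment> \<open>Well-formedness of the left side matches only concatenated words; that of the
      right side matches them factor by factor, as \<open>kron_mult\<close> requires.\<close>
    then have "length (src D1) = length (tgt D3) \<and> length (src D2) = length (tgt D4)"
      using wf by simp
    then show ?thesis using 8 wf by (simp add: dim_virtual_rep kron_mult)
  qed
next
  assume "planar_move D E"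
  then show ?thesis
    using wf move_classical(1)[of D E] diagram_cong.move J_cong[of D E]
    by (simp add: virtual_rep_classical tangle_eq_def)
next
  assume "reidemeister_move D E"
  then show ?thesis
    using wf move_classical(2)[of D E] diagram_cong.move J_cong[of D E]
    by (simp add: virtual_rep_classical tangle_eq_def)
next
  assume "virtual_planar_move D E"
  then show ?thesis
  proof cases
    case (1 s t)
    then show ?thesis
      using J_carrier[of "Cap s"] by (simp add: J_Ident flip_cap)
  next
    case (2 s t)
    then show ?thesis
      using J_carrier[of "Cup s"] by (simp add: J_Ident flip_cup)
  qed
next
  assume "virtual_move D E"
  then show ?thesis
  proof cases
    case (1 t s)
    then show ?thesis by (simp add: J_Ident flip_flip)
  next
    case (2 t u s)
    \<comment> \<open>The purely virtual relation is the mixed one with the flip itself as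
      crossing.\<close>
    then show ?thesis by (simp add: J_Ident flip_mixed)
  next
    case (3 t u s)
    then show ?thesis
      using J_carrier[of "Pos s u"] by (simp add: J_Ident flip_mixed)
  qed
qed

lemma virtual_rep_cong:
  assumes "(D, E) \<in> virtual_tangle_eq"
  shows "virtual_rep D = virtual_rep E"
proof -
  have "diagram_cong (\<lambda>_. True) (\<lambda>D E. monoidal_move D E \<or> planar_move D E \<or>
      virtual_planar_move D E \<or> reidemeister_move D E \<or> virtual_move D E) D E"
    using assms by (simp add: virtual_tangle_eq_def)
  then show ?thesis
  proof induction
    case (move D E)
    then show ?case by (intro virtual_rep_move)
  qed simp_all
qed

end


section \<open>The functor on words without parentheses\<close>

text \<open>Diagrams only know associative words, while the functor lives on parenthesised ones;
  this fixes the right-nested bracketing of each word.\<close>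

fun pword_of :: "sgn list \<Rightarrow> pword" where
  "pword_of [] = None"
| "pword_of (s # w) = pmult (Some (Letter s)) (pword_of w)"

lemma flatten_pmult [simp]: "flatten (pmult u w) = flatten u @ flatten w"
  by (induction u w rule: pmult.induct) auto

lemma flatten_pword_of [simp]: "flatten (pword_of w) = w"
  by (induction w) auto

lemma tangle_eq_refl: "wf_diagram D \<Longrightarrow> classical D \<Longrightarrow> (D, D) \<in> tangle_eq"
  by (simp add: tangle_eq_def diagram_cong.refl)

lemma tangle_class_eq: "(D, E) \<in> tangle_eq \<Longrightarrow> tangle_class D = tangle_class E"
  unfolding tangle_class_def tangle_eq_def
  by (auto dest: diagram_cong.trans diagram_cong.trans[OF diagram_cong.sym])

lemma tangle_class_in: "wf_diagram D \<Longrightarrow> classical D \<Longrightarrow> tangle_class D \<in> tangles (src D) (tgt D)"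
  by (simp add: tangles_def tangle_class_def quotientI)

locale rt_functor_data =
  fixes H :: "('k::field, 'h::ring_1) hopf_data" and V Fo Fm
  assumes is_rt: "rt_functor H V Fo Fm"
begin

lemma Fm_carrier:
  assumes "wf_diagram D" "classical D" "src D = flatten u" "tgt D = flatten w"
  shows "Fm u w (tangle_class D) \<in> carrier_mat (mdim (Fo w)) (mdim (Fo u))"
proof -
  have "Fm u w (tangle_class D) \<in> module_hom_mat (Fo u) (Fo w)"
    using is_rt tangle_class_in[OF assms(1,2)] assms(3,4) unfolding rt_functor_def by simp
  then show ?thesis by (simp add: module_hom_mat_def)
qed

lemma Fm_Ident: "flatten w = v \<Longrightarrow> Fm w w (tangle_class (Ident v)) = 1\<^sub>m (mdim (Fo w))"
  using is_rt by (auto simp: rt_functor_def)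

lemma Fm_Comp:
  assumes "wf_diagram (Comp D E)" "classical (Comp D E)"
    "src E = flatten u" "tgt E = flatten w" "tgt D = flatten x"
  shows "Fm u x (tangle_class (Comp D E)) = Fm w x (tangle_class D) * Fm u w (tangle_class E)"
  using is_rt assms by (simp add: rt_functor_def)

lemma Fm_Tens:
  assumes "wf_diagram (Tens D E)" "classical (Tens D E)"
    "src D = flatten u" "tgt D = flatten w" "src E = flatten u'" "tgt E = flatten w'"
  shows "Fm (pmult u u') (pmult w w') (tangle_class (Tens D E)) =
    kron (Fm u w (tangle_class D)) (Fm u' w' (tangle_class E))"
  using is_rt assms unfolding rt_functor_def by blast

lemma mdim_pmult: "mdim (Fo (pmult u w)) = mdim (Fo u) * mdim (Fo w)"
  using is_rt by (simp add: rt_functor_def tensor_module_def)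

lemma mdim_pword_of: "mdim (Fo (pword_of w)) = mdim V ^ length w"
proof (induction w)
  case Nil
  then show ?case using is_rt by (simp add: rt_functor_def unit_module_def)
next
  case (Cons s w)
  have "mdim (Fo (Some (Letter s))) = mdim V"
    using is_rt by (cases s) (auto simp: rt_functor_def dual_module_def)
  with Cons show ?case by (simp add: mdim_pmult del: pmult.simps)
qed

text \<open>A strict functor sends associativity constraints to identity matrices. Each letter of
  \<open>u\<close> costs one such constraint, followed by the induction hypothesis tensored with an
  identity.\<close>

lemma Fm_reassociate:
  "Fm (pmult (pword_of u) (pword_of w)) (pword_of (u @ w)) (tangle_class (Ident (u @ w))) =
    1\<^sub>m (mdim V ^ length (u @ w))"
proof (induction u)
  case Nil
  then show ?case by (simp add: Fm_Ident mdim_pword_of)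
next
  case (Cons s u)
  let ?s = "Some (Letter s)" and ?u = "pword_of u" and ?w = "pword_of w"
  \<comment> \<open>Splitting the identity tangle in two makes room for the intermediate bracketing;
    \<open>eq2\<close> then exhibits one half as a tensor product.\<close>
  have eq1: "(Comp (Ident (s # u @ w)) (Ident (s # u @ w)), Ident (s # u @ w)) \<in> tangle_eq"
    using monoidal_move.intros(2)[of "Ident (s # u @ w)"]
    by (auto simp: tangle_eq_def intro!: diagram_cong.move)
  have eq2: "(Tens (Ident [s]) (Ident (u @ w)), Ident (s # u @ w)) \<in> tangle_eq"
    using monoidal_move.intros(7)[of "[s]" "u @ w"]
    by (auto simp: tangle_eq_def intro!: diagram_cong.move)
  have assoc: "Fm (pmult (pmult ?s ?u) ?w) (pmult ?s (pmult ?u ?w)) (tangle_class (Ident (s # u @ w))) =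
      1\<^sub>m (mdim (Fo ?s) * mdim (Fo ?u) * mdim (Fo ?w))"
  proof -
    have "\<forall>u w x. Fm (pmult (pmult u w) x) (pmult u (pmult w x))
          (tangle_class (Ident (flatten u @ flatten w @ flatten x))) =
        1\<^sub>m (mdim (Fo u) * mdim (Fo w) * mdim (Fo x))"
      using is_rt unfolding rt_functor_def by blast
    from this[rule_format, of ?s ?u ?w] show ?thesis by simp
  qed
  have s: "mdim (Fo ?s) = mdim V"
    using mdim_pword_of[of "[s]"] by simp
  have dims: "mdim (Fo ?s) * mdim (Fo ?u) * mdim (Fo ?w) = mdim V ^ Suc (length u + length w)"
    by (simp add: s mdim_pword_of power_add mult.assoc del: pmult.simps)
  have "Fm (pmult (pmult ?s ?u) ?w) (pmult ?s (pword_of (u @ w))) (tangle_class (Ident (s # u @ w))) =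
      Fm (pmult ?s (pmult ?u ?w)) (pmult ?s (pword_of (u @ w))) (tangle_class (Ident (s # u @ w))) *
      Fm (pmult (pmult ?s ?u) ?w) (pmult ?s (pmult ?u ?w)) (tangle_class (Ident (s # u @ w)))"
    unfolding tangle_class_eq[OF eq1, symmetric]
    by (subst Fm_Comp) (simp_all add: tangle_class_eq[OF eq1] del: pmult.simps)
  also have "Fm (pmult ?s (pmult ?u ?w)) (pmult ?s (pword_of (u @ w))) (tangle_class (Ident (s # u @ w))) =
      1\<^sub>m (mdim V ^ Suc (length u + length w))"
    unfolding tangle_class_eq[OF eq2, symmetric]
    by (subst Fm_Tens) (simp_all add: Cons Fm_Ident s kron_one del: pmult.simps)
  finally show ?case
    unfolding assoc dims by (simp del: pmult.simps)
qed

text \<open>Functoriality makes this matrix a right inverse of the one in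
  \<open>Fm_reassociate\<close>, which is the identity.\<close>

lemma Fm_reassociate':
  "Fm (pword_of (u @ w)) (pmult (pword_of u) (pword_of w)) (tangle_class (Ident (u @ w))) =
    1\<^sub>m (mdim V ^ length (u @ w))" (is "?X = _")
proof -
  let ?p = "pmult (pword_of u) (pword_of w)" and ?I = "Ident (u @ w)"
  have eq: "(Comp ?I ?I, ?I) \<in> tangle_eq"
    using monoidal_move.intros(2)[of ?I] by (auto simp: tangle_eq_def intro!: diagram_cong.move)
  have "Fm (pword_of (u @ w)) (pword_of (u @ w)) (tangle_class (Comp ?I ?I)) =
      Fm ?p (pword_of (u @ w)) (tangle_class ?I) * ?X"
    by (rule Fm_Comp) simp_all
  moreover have "?X \<in> carrier_mat (mdim V ^ length (u @ w)) (mdim V ^ length (u @ w))"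
    using Fm_carrier[of ?I "pword_of (u @ w)" ?p]
    by (simp add: mdim_pmult mdim_pword_of power_add del: pmult.simps)
  ultimately show ?thesis
    by (simp add: Fm_reassociate tangle_class_eq[OF eq] Fm_Ident mdim_pword_of)
qed

definition rep :: "diagram \<Rightarrow> 'k mat" where
  "rep D = Fm (pword_of (src D)) (pword_of (tgt D)) (tangle_class D)"

text \<open>The chosen bracketing of a concatenation is not the product of the chosen bracketings.
  Identity tangles inserted at both ends change one into the other, and their matrices are
  identities.\<close>

lemma rep_Tens:
  assumes wf: "wf_diagram (Tens D E)" and cl: "classical (Tens D E)"
  shows "rep (Tens D E) = kron (rep D) (rep E)"
proof -
  let ?T = "Tens D E"
  let ?p = "pmult (pword_of (src D)) (pword_of (src E))"
  let ?q = "pmult (pword_of (tgt D)) (pword_of (tgt E))"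
  have eq: "(Comp (Ident (tgt ?T)) ?T, ?T) \<in> tangle_eq" "(Comp ?T (Ident (src ?T)), ?T) \<in> tangle_eq"
    using wf cl monoidal_move.intros(2,3)[of ?T]
    by (auto simp: tangle_eq_def intro!: diagram_cong.move)
  have car: "Fm ?p (pword_of (tgt ?T)) (tangle_class ?T) \<in>
      carrier_mat (mdim V ^ length (tgt ?T)) (mdim V ^ length (src ?T))"
    "Fm ?p ?q (tangle_class ?T) \<in> carrier_mat (mdim V ^ length (tgt ?T)) (mdim V ^ length (src ?T))"
    using Fm_carrier[OF wf cl, of ?p "pword_of (tgt ?T)"] Fm_carrier[OF wf cl, of ?p ?q]
    by (simp_all add: mdim_pmult mdim_pword_of power_add del: pmult.simps)
  have "rep ?T = Fm (pword_of (src ?T)) (pword_of (tgt ?T)) (tangle_class (Comp ?T (Ident (src ?T))))"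
    by (simp only: rep_def tangle_class_eq[OF eq(2)])
  also have "\<dots> = Fm ?p (pword_of (tgt ?T)) (tangle_class ?T) *
      Fm (pword_of (src ?T)) ?p (tangle_class (Ident (src ?T)))"
    using wf cl by (intro Fm_Comp) simp_all
  also have "\<dots> = Fm ?p (pword_of (tgt ?T)) (tangle_class ?T)"
    using car Fm_reassociate'[of "src D" "src E"] by simp
  also have "\<dots> = Fm ?p (pword_of (tgt ?T)) (tangle_class (Comp (Ident (tgt ?T)) ?T))"
    by (simp only: tangle_class_eq[OF eq(1)])
  also have "\<dots> = Fm ?q (pword_of (tgt ?T)) (tangle_class (Ident (tgt ?T))) * Fm ?p ?q (tangle_class ?T)"
    using wf cl by (intro Fm_Comp) simp_all
  also have "\<dots> = Fm ?p ?q (tangle_class ?T)"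
    using car Fm_reassociate[of "tgt D" "tgt E"] by simp
  also have "\<dots> = kron (rep D) (rep E)"
    using wf cl unfolding rep_def by (intro Fm_Tens) simp_all
  finally show ?thesis .
qed

sublocale tangle_representation "mdim V" rep
proof
  fix D E
  show "rep (Ident w) = 1\<^sub>m (mdim V ^ length w)" for w
    by (simp add: rep_def Fm_Ident mdim_pword_of)
  show "rep D \<in> carrier_mat (mdim V ^ length (tgt D)) (mdim V ^ length (src D))"
    if "wf_diagram D" "classical D"
    using Fm_carrier[OF that, of "pword_of (src D)" "pword_of (tgt D)"]
    by (simp add: rep_def mdim_pword_of)
  show "rep (Comp D E) = rep D * rep E" if "wf_diagram (Comp D E)" "classical (Comp D E)"
    using Fm_Comp[OF that, of "pword_of (src E)" "pword_of (tgt E)" "pword_of (tgt D)"] that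
    by (simp add: rep_def)
  show "rep (Tens D E) = kron (rep D) (rep E)" if "wf_diagram (Tens D E)" "classical (Tens D E)"
    using rep_Tens[OF that] .
  show "rep D = rep E" if "(D, E) \<in> tangle_eq"
  proof -
    \<comment> \<open>\<open>rep\<close> reads its end words off the diagram, so equivalent diagrams
      must first be seen to share them.\<close>
    have "src D = src E \<and> tgt D = tgt E"
      using that diagram_cong_types[of classical _ D E] move_types unfolding tangle_eq_def by blast
    then show ?thesis
      using tangle_class_eq[OF that] by (simp add: rep_def)
  qed
qed

end


section \<open>The virtual invariant\<close>

lemma tangle_eq_virtual:
  assumes "(D, E) \<in> tangle_eq"
  shows "(D, E) \<in> virtual_tangle_eq"
proof -
  have "diagram_cong classical
      (\<lambda>D E. monoidal_move D E \<or> planar_move D E \<or> reidemeister_move D E) D E"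
    using assms by (simp add: tangle_eq_def)
  then show ?thesis
    unfolding virtual_tangle_eq_def mem_Collect_eq prod.case
  proof induction
    case (move D E)
    then show ?case by (intro diagram_cong.move) auto
  next
    case (refl D)
    then show ?case by (intro diagram_cong.refl) auto
  next
    case (sym D E)
    show ?case by (rule diagram_cong.sym[OF sym.IH])
  next
    case (trans D E F)
    show ?case by (rule diagram_cong.trans[OF trans.IH])
  next
    case (Comp D D' E E')
    show ?case by (rule diagram_cong.Comp[OF Comp.IH Comp.hyps(3)])
  next
    case (Tens D D' E E')
    show ?case by (rule diagram_cong.Tens[OF Tens.IH])
  qed
qed

lemma as_virtual_tangle_class:
  assumes "wf_diagram D" "classical D"
  shows "as_virtual (tangle_class D) = virtual_tangle_eq `` {D}"
proof -
  have "(D, F) \<in> virtual_tangle_eq" if "(D, E) \<in> virtual_tangle_eq" "(E, F) \<in> virtual_tangle_eq" for E F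
    using that diagram_cong.trans[of _ _ D E F] by (simp add: virtual_tangle_eq_def)
  then show ?thesis
    using tangle_eq_refl[OF assms] tangle_eq_virtual
    by (auto simp: as_virtual_def tangle_class_def)
qed

text \<open>
  Quantifying over all bases and functors in the same way as \<^const>\<open>reshetikhin_turaev\<close> does makes the
  two descriptions agree on classical links without appeal to existence or uniqueness of the functor.
\<close>

definition virtual_invariant ::
  "('k::field, 'h::ring_1) hopf_data \<Rightarrow> ('k \<Rightarrow> 'v::ab_group_add \<Rightarrow> 'v) \<Rightarrow> ('h \<Rightarrow> 'v \<Rightarrow> 'v) \<Rightarrow>
   diagram set \<Rightarrow> 'k" where
  "virtual_invariant H sv act K =
     (THE c. \<exists>bs Fo Fm. ordered_basis sv bs \<and> rt_functor H (coordinate_module sv act bs) Fo Fm \<and>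
        (\<exists>D \<in> K. c = tangle_representation.virtual_rep (length bs) (rt_functor_data.rep Fm) D $$ (0, 0)))"

text \<open>For every basis and functor the conditions under the two descriptions are equivalent, so
  both pick the same scalar.\<close>

lemma virtual_invariant_as_virtual:
  assumes "L \<in> framed_links"
  shows "virtual_invariant H sv act (as_virtual L) = reshetikhin_turaev H sv act L"
proof -
  from assms obtain D where D: "wf_diagram D" "classical D" "src D = []" "tgt D = []"
    and L: "L = tangle_class D"
    by (auto simp: tangles_def tangle_class_def elim!: quotientE)
  have "(\<exists>E \<in> as_virtual L. c = tangle_representation.virtual_rep (length bs) (rt_functor_data.rep Fm) E $$ (0, 0))
      \<longleftrightarrow> c = Fm None None L $$ (0, 0)"
    if "rt_functor H (coordinate_module sv act bs) Fo Fm" for bs Fo Fm c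
  proof -
    interpret rt_functor_data H "coordinate_module sv act bs" Fo Fm
      by unfold_locales (fact that)
    have n: "mdim (coordinate_module sv act bs) = length bs"
      by (simp add: coordinate_module_def)
    \<comment> \<open>Invariance reduces \<open>E\<close> to the classical diagram \<open>D\<close>,
      where the extension agrees with \<open>rep\<close>; the empty word has the bracketing
      \<open>None\<close>.\<close>
    have "virtual_rep E = Fm None None L" if "E \<in> as_virtual L" for E
      using that D virtual_rep_cong[of D E]
      by (simp add: L as_virtual_tangle_class virtual_rep_classical rep_def)
    \<comment> \<open>The existential needs a witness: the class contains \<open>D\<close>.\<close>
    moreover have "D \<in> as_virtual L"
      using D tangle_eq_refl tangle_eq_virtual by (auto simp: L as_virtual_tangle_class)
    ultimately show ?thesis
      unfolding n by metis
  qed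
  then show ?thesis
    unfolding virtual_invariant_def reshetikhin_turaev_def
    by (intro arg_cong[where f = The] ext ex_cong1 conj_cong HOL.refl)
qed

theorem proposition4p2:
  fixes H :: "('k::field, 'h::ring_1) hopf_data"
    and sv :: "'k \<Rightarrow> 'v::ab_group_add \<Rightarrow> 'v"
    and act :: "'h \<Rightarrow> 'v \<Rightarrow> 'v"
  assumes "ribbon_hopf_algebra H"
    and "fd_module H sv act"
  shows "\<exists>I \<in> framed_virtual_links \<rightarrow>\<^sub>E (UNIV :: 'k set).
    \<forall>L \<in> framed_links. I (as_virtual L) = reshetikhin_turaev H sv act L"
proof (intro bexI ballI)
  \<comment> \<open>Restriction makes the invariant extensional, as membership in the function space
    demands.\<close>
  let ?I = "restrict (virtual_invariant H sv act) framed_virtual_links"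
  show "?I \<in> framed_virtual_links \<rightarrow>\<^sub>E UNIV"
    by simp
  fix L assume L: "L \<in> framed_links"
  then obtain D where "wf_diagram D" "classical D" "src D = []" "tgt D = []" "L = tangle_class D"
    by (auto simp: tangles_def tangle_class_def elim!: quotientE)
  \<comment> \<open>The argument lies in the domain, so the restricted function does not return
    \<open>undefined\<close> there.\<close>
  then have "as_virtual L \<in> framed_virtual_links"
    by (auto simp: as_virtual_tangle_class virtual_tangles_def intro: quotientI)
  then show "?I (as_virtual L) = reshetikhin_turaev H sv act L"
    using L by (simp add: virtual_invariant_as_virtual)
qed

end
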